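(* In the setting described in the context, let $X=H$ be a Hilbert space with inner product $(\cdot,\cdot)_H$, let $\mathsf P_h:=\mathsf M_h^{-1}\mathsf C_h\mathsf N_h^{-1}$, and assume that $$\frac{\gamma_{\mathsf C}\gamma_{\mathsf A}}{\|\mathsf m\|\|\mathsf n\|}\le\mathcal V_H(\mathsf P_h\mathsf A_h)\quad\text{and}\quad\frac{\gamma_{\mathsf M}\gamma_{\mathsf N}}{\|\mathsf c\|\|\mathsf a\|}\le\mathcal V_H((\mathsf P_h\mathsf A_h)^{-1}).$$ Consider weighted and Euclidean GMRES$(m)$ applied to the preconditioned system $\mathbf P\mathbf A\mathbf u=\mathbf P\mathbf b$ with $\mathbf P:=\mathbf M^{-1}\mathbf C\mathbf N^{-1}$. Then, for all $1\le k,m\le N$, the convergence rates satisfy $$\Theta_k^{(m)}\le\left(1-\frac1{K_\star}\right)^{1/2}\quad\text{and}\quad\widetilde\Theta_k^{(m)}\le K_{\Lambda_h}\left(1-\frac1{K_\star}\right)^{1/2},\qquad K_\star:=\frac{\|\mathsf m\|\|\mathsf n\|\|\mathsf c\|\|\mathsf a\|}{\gamma_{\mathsf M}\gamma_{\mathsf N}\gamma_{\mathsf C}\gamma_{\mathsf A}}.$$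
   Context: Setting. $X=H$ is a complex Hilbert space with norm $\|\cdot\|_X=\|\cdot\|_H=\sqrt{(\cdot,\cdot)_H}$, and $Y,V,W$ are complex reflexive Banach spaces. $\mathsf a$ on $X\times Y$, $\mathsf c$ on $V\times W$, $\mathsf n$ on $V\times Y$ and $\mathsf m$ on $X\times W$ are bounded sesquilinear forms (linear in the first, antilinear in the second argument), with norms $\|\mathsf a\|=\sup_{x\ne0,y\ne0}|\mathsf a(x,y)|/(\|x\|_X\|y\|_Y)$, and similarly $\|\mathsf c\|,\|\mathsf n\|,\|\mathsf m\|$. A prime denotes the space of bounded antilinear functionals; $b\in Y'$. It is assumed that for every $b\in Y'$ there is a unique $u\in X$ with $\mathsf a(u,v)=b(v)$ for all $v\in Y$. For a fixed index $h>0$, $X_h\subset X$, $Y_h\subset Y$, $V_h\subset V$, $W_h\subset W$ are subspaces of the same finite dimension $N$. Discrete inf-sup conditions: there is $\gamma_{\mathsf A}>0$ with $\sup_{v_h\in Y_h\setminus\{0\}}|\mathsf a(u_h,v_h)|/\|v_h\|_Y\ge\gamma_{\mathsf A}\|u_h\|_X$ for all $u_h\in X_h$; likewise $\mathsf c$ on $V_h\times W_h$, $\mathsf n$ on $V_h\times Y_h$, $\mathsf m$ on $X_h\times W_h$ satisfy the analogous condition (supremum over the second argument) with constants $\gamma_{\mathsf C},\gamma_{\mathsf N},\gamma_{\mathsf M}>0$. Discrete operators: $\mathsf A_h:X_h\to Y_h'$, $\langle\mathsf A_hu_h,v_h\rangle=\mathsf a(u_h,v_h)$; analogously $\mathsf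 C_h:V_h\to W_h'$, $\mathsf N_h:V_h\to Y_h'$, $\mathsf M_h:X_h\to W_h'$. For $\mathsf Q_h:X_h\to X_h$ linear, $\mathcal V_H(\mathsf Q_h)=\inf_{u_h\in X_h\setminus\{0\}}|(\mathsf Q_hu_h,u_h)_H|/(u_h,u_h)_H$. Matrices: given bases $\{\varphi_i\}$ of $X_h$, $\{\phi_i\}$ of $Y_h$, $\{\psi_i\}$ of $V_h$, $\{\xi_i\}$ of $W_h$, $\mathbf A=(\mathsf a(\varphi_j,\phi_i))_{i,j}$, $\mathbf C=(\mathsf c(\psi_j,\xi_i))_{i,j}$, $\mathbf N=(\mathsf n(\psi_j,\phi_i))_{i,j}$, $\mathbf M=(\mathsf m(\varphi_j,\xi_i))_{i,j}$, $\mathbf b=(b(\phi_i))_i$. The Gram matrix $\mathbf H=((\varphi_j,\varphi_i)_H)_{i,j}$ defines $(\mathbf u,\mathbf v)_H=(\mathbf H\mathbf u,\mathbf v)_2$ and $\|\mathbf u\|_H=\sqrt{(\mathbf u,\mathbf u)_H}$ on $\mathbb C^N$. Synthesis operator: $\Lambda_h:\mathbb C^N\to X_h$, $\mathbf u=(u_i)\mapsto u_h=\sum_iu_i\varphi_i$; $\gamma_{\Lambda_h}=\inf_{u_h\ne0}\|u_h\|_X/\|\mathbf u\|_2$, $\|\Lambda_h\|=\sup_{u_h\ne0}\|u_h\|_X/\|\mathbf u\|_2$, $K_{\Lambda_h}=\|\Lambda_h\|/\gamma_{\Lambda_h}$. GMRES$(m)$: for a nonsingular $\mathbf Q\in\mathbb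 C^{N\times N}$, $\mathbf d\in\mathbb C^N$ and initial guess $\mathbf x_0$ not equal to the solution, weighted GMRES$(m)$ for $\mathbf Q\mathbf x=\mathbf d$ produces iterates as follows: for $k=im+t$ with $i\ge0$, $1\le t\le m$, $\mathbf x_k$ is the unique minimizer of $\|\mathbf d-\mathbf Q\mathbf x\|_H$ over $\mathbf x\in\mathbf x_{im}+\mathcal K^t(\mathbf Q,\mathbf d-\mathbf Q\mathbf x_{im})$, where $\mathcal K^t(\mathbf Q,\mathbf r)=\mathrm{span}\{\mathbf Q^j\mathbf r:0\le j\le t-1\}$. Euclidean GMRES$(m)$ produces $\tilde{\mathbf x}_k$ in the same way with $\|\cdot\|_2$ instead of $\|\cdot\|_H$ and $\tilde{\mathbf x}_0=\mathbf x_0$. Here $\mathbf Q=\mathbf P\mathbf A$, $\mathbf d=\mathbf P\mathbf b$, $\mathbf r_k=\mathbf b-\mathbf A\mathbf x_k$, $\tilde{\mathbf r}_k=\mathbf b-\mathbf A\tilde{\mathbf x}_k$, and $$\Theta_k^{(m)}=\left(\frac{\|\mathbf P\mathbf r_k\|_H}{\|\mathbf P\mathbf r_0\|_H}\right)^{1/k},\qquad\widetilde\Theta_k^{(m)}=\left(\frac{\|\mathbf P\tilde{\mathbf r}_k\|_2}{\|\mathbf P\mathbf r_0\|_2}\right)^{1/k}.$$ *)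

theory Defs
  imports "HOL-Analysis.Analysis"
begin

section \<open>Complex normed, Banach and Hilbert spaces\<close>

class complex_normed_vector = real_normed_vector +
  fixes scaleC :: "complex \<Rightarrow> 'a \<Rightarrow> 'a"  (infixr \<open>*\<^sub>C\<close> 75)
  assumes scaleC_of_real: "complex_of_real r *\<^sub>C x = r *\<^sub>R x"
    and scaleC_add_right: "c *\<^sub>C (x + y) = c *\<^sub>C x + c *\<^sub>C y"
    and scaleC_add_left: "(c + d) *\<^sub>C x = c *\<^sub>C x + d *\<^sub>C x"
    and scaleC_scaleC: "c *\<^sub>C (d *\<^sub>C x) = (c * d) *\<^sub>C x"
    and norm_scaleC: "norm (c *\<^sub>C x) = cmod c * norm x"

class complex_banach = complex_normed_vector + banach

text \<open>The inner product is linear in the first argument and antilinear in the second.\<close>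

class complex_hilbert = complex_banach +
  fixes cinner :: "'a \<Rightarrow> 'a \<Rightarrow> complex"
  assumes cinner_commute: "cinner x y = cnj (cinner y x)"
    and cinner_add_left: "cinner (x + y) z = cinner x z + cinner y z"
    and cinner_scaleC_left: "cinner (c *\<^sub>C x) y = c * cinner x y"
    and cinner_ge_zero: "0 \<le> Re (cinner x x)"
    and norm_eq_sqrt_cinner: "norm x = sqrt (Re (cinner x x))"

interpretation cvec: vector_space "scaleC :: complex \<Rightarrow> 'a \<Rightarrow> 'a::complex_normed_vector"
proof
  show "1 *\<^sub>C x = x" for x :: 'a
    using scaleC_of_real[of 1 x] by simp
qed (simp_all add: scaleC_add_right scaleC_add_left scaleC_scaleC)

text \<open>
  Bounded antilinear functionals on a subspace \<open>S\<close>. They are extended by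
  \<open>undefined\<close> outside \<open>S\<close>, so that equality of functions is equality of functionals
  on \<open>S\<close>.
\<close>

definition antidual :: "'a::complex_normed_vector set \<Rightarrow> ('a \<Rightarrow> complex) set" where
  "antidual S = {f \<in> extensional S.
     (\<forall>x\<in>S. \<forall>y\<in>S. f (x + y) = f x + f y) \<and>
     (\<forall>c. \<forall>x\<in>S. f (c *\<^sub>C x) = cnj c * f x) \<and>
     (\<exists>K. \<forall>x\<in>S. cmod (f x) \<le> K * norm x)}"

text \<open>
  Reflexivity: the canonical map into the bidual is onto. As the elements of the dual
  are antilinear, the functional on the dual induced by \<open>x\<close> is \<open>\<lambda>f. cnj (f x)\<close>.
\<close>

definition reflexive_space :: "'a::complex_normed_vector itself \<Rightarrow> bool" where
  "reflexive_space _ \<longleftrightarrow> (\<forall>F :: ('a \<Rightarrow> complex) \<Rightarrow> complex.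
     (\<forall>f\<in>antidual UNIV. \<forall>g\<in>antidual UNIV. F (\<lambda>x. f x + g x) = F f + F g) \<longrightarrow>
     (\<forall>c. \<forall>f\<in>antidual UNIV. F (\<lambda>x. c * f x) = cnj c * F f) \<longrightarrow>
     (\<exists>K. \<forall>f\<in>antidual UNIV. cmod (F f) \<le> K * onorm f) \<longrightarrow>
     (\<exists>x. \<forall>f\<in>antidual UNIV. F f = cnj (f x)))"


section \<open>Sesquilinear forms and their discretisation\<close>

definition bounded_sesquilinear ::
    "('a::complex_normed_vector \<Rightarrow> 'b::complex_normed_vector \<Rightarrow> complex) \<Rightarrow> bool" where
  "bounded_sesquilinear f \<longleftrightarrow>
     (\<forall>x x' y. f (x + x') y = f x y + f x' y) \<and>
     (\<forall>c x y. f (c *\<^sub>C x) y = c * f x y) \<and>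
     (\<forall>x y y'. f x (y + y') = f x y + f x y') \<and>
     (\<forall>c x y. f x (c *\<^sub>C y) = cnj c * f x y) \<and>
     (\<exists>K. \<forall>x y. cmod (f x y) \<le> K * norm x * norm y)"

definition form_norm ::
    "('a::complex_normed_vector \<Rightarrow> 'b::complex_normed_vector \<Rightarrow> complex) \<Rightarrow> real" where
  "form_norm f = (SUP (x, y) \<in> (UNIV - {0}) \<times> (UNIV - {0}). cmod (f x y) / (norm x * norm y))"

definition inf_sup ::
    "('a::complex_normed_vector \<Rightarrow> 'b::complex_normed_vector \<Rightarrow> complex) \<Rightarrow>
     'a set \<Rightarrow> 'b set \<Rightarrow> real \<Rightarrow> bool" where
  "inf_sup f S T \<gamma> \<longleftrightarrow>
     \<gamma> > 0 \<and> (\<forall>u\<in>S. (SUP v\<in>T - {0}. cmod (f u v) / norm v) \<ge> \<gamma> * norm u)"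

text \<open>
  The operator from \<open>S\<close> to the antidual of \<open>T\<close> induced by a form. If \<open>f\<close> satisfies
  \<open>inf_sup f S T \<gamma>\<close> and \<open>S\<close>, \<open>T\<close> have the same finite dimension, it is a bijection, and
  \<open>inv_into S (discrete_op f S T)\<close> is its inverse.
\<close>

definition discrete_op ::
    "('a::complex_normed_vector \<Rightarrow> 'b::complex_normed_vector \<Rightarrow> complex) \<Rightarrow>
     'a set \<Rightarrow> 'b set \<Rightarrow> 'a \<Rightarrow> 'b \<Rightarrow> complex" where
  "discrete_op f S T = (\<lambda>u\<in>S. \<lambda>v\<in>T. f u v)"

lemma discrete_op_antidual:
  assumes "bounded_sesquilinear f" and "cvec.subspace T"
  shows "discrete_op f S T \<in> S \<rightarrow>\<^sub>E antidual T"
proof (rule PiE_I)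
  fix u assume "u \<in> S"
  obtain K where "\<forall>x y. cmod (f x y) \<le> K * norm x * norm y"
    using assms(1) unfolding bounded_sesquilinear_def by blast
  hence "\<exists>K. \<forall>v\<in>T. cmod (f u v) \<le> K * norm v" by blast
  thus "discrete_op f S T u \<in> antidual T"
    using assms \<open>u \<in> S\<close> unfolding antidual_def discrete_op_def bounded_sesquilinear_def
    by (auto simp: cvec.subspace_add cvec.subspace_scale)
qed (simp add: discrete_op_def)

text \<open>\<open>cinner u u\<close> is real, so its real part is the squared norm.\<close>

definition field_of_values_dist ::
    "'a::complex_hilbert set \<Rightarrow> ('a \<Rightarrow> 'a) \<Rightarrow> real" where
  "field_of_values_dist S Q = (INF u\<in>S - {0}. cmod (cinner (Q u) u) / Re (cinner u u))"


section \<open>Bases and matrices\<close>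

definition is_basis :: "('n::finite \<Rightarrow> 'a::complex_normed_vector) \<Rightarrow> 'a set \<Rightarrow> bool" where
  "is_basis \<phi> S \<longleftrightarrow> inj \<phi> \<and> cvec.independent (range \<phi>) \<and> cvec.span (range \<phi>) = S"

definition form_matrix ::
    "('a \<Rightarrow> 'b \<Rightarrow> complex) \<Rightarrow> ('n::finite \<Rightarrow> 'a) \<Rightarrow> ('n \<Rightarrow> 'b) \<Rightarrow> complex ^ 'n ^ 'n" where
  "form_matrix f \<phi> \<psi> = (\<chi> i j. f (\<phi> j) (\<psi> i))"

definition gram_norm ::
    "('n::finite \<Rightarrow> 'a::complex_hilbert) \<Rightarrow> complex ^ 'n \<Rightarrow> real" where
  "gram_norm \<phi> u = sqrt (Re (\<Sum>i\<in>UNIV. (form_matrix cinner \<phi> \<phi> *v u) $ i * cnj (u $ i)))"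

definition synthesis ::
    "('n::finite \<Rightarrow> 'a::complex_normed_vector) \<Rightarrow> complex ^ 'n \<Rightarrow> 'a" where
  "synthesis \<phi> u = (\<Sum>i\<in>UNIV. (u $ i) *\<^sub>C \<phi> i)"

text \<open>The library norm on \<open>complex ^ 'n\<close> is the Euclidean one.\<close>

definition synthesis_cond :: "('n::finite \<Rightarrow> 'a::complex_normed_vector) \<Rightarrow> real" where
  "synthesis_cond \<phi> =
     (SUP u\<in>{u. synthesis \<phi> u \<noteq> 0}. norm (synthesis \<phi> u) / norm u) /
     (INF u\<in>{u. synthesis \<phi> u \<noteq> 0}. norm (synthesis \<phi> u) / norm u)"


section \<open>Restarted GMRES\<close>

definition krylov ::
    "complex ^ 'n ^ 'n \<Rightarrow> complex ^ 'n::finite \<Rightarrow> nat \<Rightarrow> (complex ^ 'n) set" where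
  "krylov Q r t = vec.span ((\<lambda>j. (((*v) Q) ^^ j) r) ` {..<t})"

text \<open>
  The sequence \<open>x\<close> is produced by GMRES(\<open>m\<close>) for \<open>Q x = d\<close> with respect to the norm
  \<open>nrm\<close>, started at \<open>x0\<close>. Uniqueness of the minimisers is a consequence when \<open>Q\<close> is
  nonsingular and \<open>nrm\<close> comes from an inner product; it is not part of the definition.
\<close>

definition gmres_iterates ::
    "(complex ^ 'n \<Rightarrow> real) \<Rightarrow> complex ^ 'n ^ 'n \<Rightarrow> complex ^ 'n \<Rightarrow> nat \<Rightarrow>
     complex ^ 'n::finite \<Rightarrow> (nat \<Rightarrow> complex ^ 'n) \<Rightarrow> bool" where
  "gmres_iterates nrm Q d m x0 x \<longleftrightarrow>
     x 0 = x0 \<and>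
     (\<forall>i t. 1 \<le> t \<and> t \<le> m \<longrightarrow>
        is_arg_min (\<lambda>z. nrm (d - Q *v z))
          (\<lambda>z. z \<in> (+) (x (i * m)) ` krylov Q (d - Q *v x (i * m)) t)
          (x (i * m + t)))"

definition convergence_rate ::
    "(complex ^ 'n \<Rightarrow> real) \<Rightarrow> complex ^ 'n ^ 'n \<Rightarrow> complex ^ 'n ^ 'n \<Rightarrow> complex ^ 'n::finite \<Rightarrow>
     (nat \<Rightarrow> complex ^ 'n) \<Rightarrow> nat \<Rightarrow> real" where
  "convergence_rate nrm P A b x k =
     root k (nrm (P *v (b - A *v x k)) / nrm (P *v (b - A *v x 0)))"

end

theory Submission
  imports Defs
begin

text \<open>
  If \<open>r\<close> is a residual and \<open>Q = P A\<close>, then minimising \<open>\<parallel>r - \<alpha> Q r\<parallel>\<close> over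
  \<open>\<alpha>\<close> multiplies \<open>\<parallel>r\<parallel>\<^sup>2\<close> by
  \<open>1 - (\<bar>(Q r, r)\<bar> / \<parallel>r\<parallel>\<^sup>2) (\<bar>(r, Q r)\<bar> / \<parallel>Q r\<parallel>\<^sup>2)\<close>. The first factor is at least
  the distance of the field of values of \<open>Q\<close> to the origin; the second, with
  \<open>s = Q r\<close>, is \<open>\<bar>(Q\<^sup>-\<^sup>1 s, s)\<bar> / \<parallel>s\<parallel>\<^sup>2\<close> and is bounded below by that of
  \<open>Q\<^sup>-\<^sup>1\<close>. As each GMRES step, also right after a restart, is at least as good as
  one such step from the previous iterate, the residual shrinks by \<open>(1 - 1/K)\<^sup>1\<^sup>/\<^sup>2\<close> per
  step. In the Euclidean norm the same step costs at most a further factor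
  \<open>K\<^sub>\<Lambda>\<close>, so that the \<open>k\<close>-th root leaves one factor \<open>K\<^sub>\<Lambda>\<close>.
\<close>

section \<open>Restarted GMRES\<close>

lemma krylov_zero: "0 \<in> krylov Q r t"
  unfolding krylov_def by (rule vec.span_zero)

lemma krylov_mono: "s \<le> t \<Longrightarrow> krylov Q r s \<subseteq> krylov Q r t"
  unfolding krylov_def by (intro vec.span_mono image_mono) auto

lemma krylov_start: "r \<in> krylov Q r (Suc t)"
  unfolding krylov_def by (rule vec.span_base, rule image_eqI[of _ _ 0]) auto

lemma krylov_mult:
  assumes "z \<in> krylov Q r t"
  shows "Q *v z \<in> krylov Q r (Suc t)"
proof -
  have "(*v) Q ` krylov Q r t
      = vec.span ((*v) Q ` (\<lambda>j. (((*v) Q) ^^ j) r) ` {..<t})"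
    unfolding krylov_def by (rule matrix_vector_mul_linear_gen
        [THEN vec.linear_span_image, symmetric])
  also have "\<dots> \<subseteq> krylov Q r (Suc t)"
    unfolding krylov_def
  proof (intro vec.span_mono subsetI)
    fix y assume "y \<in> (*v) Q ` (\<lambda>j. (((*v) Q) ^^ j) r) ` {..<t}"
    then obtain j where "j < t" "y = (((*v) Q) ^^ Suc j) r" by auto
    thus "y \<in> (\<lambda>j. (((*v) Q) ^^ j) r) ` {..<Suc t}"
      by (intro image_eqI[of _ _ "Suc j"]) auto
  qed
  finally show ?thesis using assms by blast
qed

text \<open>The competitor, \<open>x k\<close> plus \<alpha> times its residual, lies in the affine
  Krylov space over which \<open>x (Suc k)\<close> minimises.\<close>

lemma gmres_iterates_step:
  assumes "gmres_iterates nrm Q d m x0 x" and "1 \<le> m"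
  shows "nrm (d - Q *v x (Suc k)) \<le> nrm ((d - Q *v x k) - \<alpha> *s (Q *v (d - Q *v x k)))"
proof -
  \<comment> \<open>\<open>Suc k\<close> is step \<open>t + 1\<close> of the cycle started at
    \<open>x (i * m)\<close>, and \<open>t < m\<close> keeps it inside that cycle. Right after a
    restart \<open>t = 0\<close> and \<open>x k\<close> is the starting point itself.\<close>
  define i t where "i = k div m" and "t = k mod m"
  have k: "k = i * m + t" and t: "t < m"
    using assms(2) by (auto simp: i_def t_def)
  define r where "r = d - Q *v x (i * m)"
  have iter: "is_arg_min (\<lambda>z. nrm (d - Q *v z)) (\<lambda>z. z \<in> (+) (x (i * m)) ` krylov Q r s)
      (x (i * m + s))" if "1 \<le> s" "s \<le> m" for s
    using assms(1) that unfolding gmres_iterates_def r_def by blast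
  have "x k \<in> (+) (x (i * m)) ` krylov Q r t"
  proof (cases "t = 0")
    case True
    thus ?thesis using k krylov_zero by (intro image_eqI[of _ _ 0]) auto
  next
    case False
    thus ?thesis using iter[of t] t k by (simp add: is_arg_min_def)
  qed
  then obtain z where z: "z \<in> krylov Q r t" "x k = x (i * m) + z" by blast
  define w where "w = d - Q *v x k"
  \<comment> \<open>Multiplication by \<open>Q\<close> raises the Krylov index by one, which places
    the current residual \<open>w\<close> in the next space.\<close>
  have "w = r - Q *v z"
    by (simp add: w_def r_def z(2) matrix_vector_right_distrib)
  hence "w \<in> krylov Q r (Suc t)"
    using krylov_start krylov_mult[OF z(1)] unfolding krylov_def by (metis vec.span_diff)
  hence "z + \<alpha> *s w \<in> krylov Q r (Suc t)"
    using z(1) krylov_mono[of t "Suc t" Q r] unfolding krylov_def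
    by (intro vec.span_add vec.span_scale) auto
  hence "x k + \<alpha> *s w \<in> (+) (x (i * m)) ` krylov Q r (Suc t)"
    using z(2) by (auto simp: add.assoc)
  hence "nrm (d - Q *v x (Suc k)) \<le> nrm (d - Q *v (x k + \<alpha> *s w))"
    using iter[of "Suc t"] t k by (auto simp: is_arg_min_def not_less)
  also have "d - Q *v (x k + \<alpha> *s w) = w - \<alpha> *s (Q *v w)"
    by (simp add: w_def vec.scale algebra_simps)
  finally show ?thesis by (simp add: w_def)
qed

text \<open>The contraction is assumed at every vector, with \<alpha> depending on it. It therefore
  applies to each residual in turn, across restarts, and the factors multiply.\<close>

lemma gmres_iterates_residual_le:
  assumes "gmres_iterates nrm Q d m x0 x" and "1 \<le> m" and "0 \<le> \<rho>"
    and "\<And>r. \<exists>\<alpha>. nrm (r - \<alpha> *s (Q *v r)) \<le> \<rho> * nrm r"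
  shows "nrm (d - Q *v x k) \<le> \<rho> ^ k * nrm (d - Q *v x 0)"
proof (induction k)
  case (Suc k)
  obtain \<alpha> where "nrm ((d - Q *v x k) - \<alpha> *s (Q *v (d - Q *v x k))) \<le> \<rho> * nrm (d - Q *v x k)"
    using assms(4) by blast
  hence "nrm (d - Q *v x (Suc k)) \<le> \<rho> * nrm (d - Q *v x k)"
    using gmres_iterates_step[OF assms(1,2)] order_trans by blast
  also have "\<dots> \<le> \<rho> * (\<rho> ^ k * nrm (d - Q *v x 0))"
    using Suc assms(3) by (rule mult_left_mono)
  finally show ?case by (simp add: mult.assoc)
qed simp

lemma convergence_rate_le:
  assumes "gmres_iterates nrm (P ** A) (P *v b) m x0 x" and "1 \<le> m" and "0 \<le> \<rho>"
    and "\<And>r. \<exists>\<alpha>. nrm (r - \<alpha> *s ((P ** A) *v r)) \<le> \<rho> * nrm r"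
    and "1 \<le> k" and "0 < nrm (P *v b - (P ** A) *v x0)"
  shows "convergence_rate nrm P A b x k \<le> \<rho>"
proof -
  have res: "P *v (b - A *v z) = P *v b - (P ** A) *v z" for z
    by (simp add: matrix_vector_mult_diff_distrib matrix_vector_mul_assoc)
  have "x 0 = x0" using assms(1) by (simp add: gmres_iterates_def)
  hence "nrm (P *v (b - A *v x k)) / nrm (P *v (b - A *v x 0)) \<le> \<rho> ^ k"
    using gmres_iterates_residual_le[OF assms(1-4), of k] assms(6)
    by (simp add: res pos_divide_le_eq)
  hence "convergence_rate nrm P A b x k \<le> root k (\<rho> ^ k)"
    using assms(5) by (simp add: convergence_rate_def)
  also have "\<dots> = \<rho>" using assms(3,5) by (simp add: real_root_power_cancel)
  finally show ?thesis .
qed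

section \<open>Synthesis operator\<close>

lemma synthesis_add: "synthesis \<phi> (u + v) = synthesis \<phi> u + synthesis \<phi> v"
  by (simp add: synthesis_def scaleC_add_left sum.distrib)

lemma synthesis_scale: "synthesis \<phi> (\<alpha> *s u) = \<alpha> *\<^sub>C synthesis \<phi> u"
  by (simp add: synthesis_def cvec.scale_sum_right)

lemma synthesis_diff: "synthesis \<phi> (u - v) = synthesis \<phi> u - synthesis \<phi> v"
  by (metis add_diff_cancel_right' diff_add_cancel synthesis_add)

text \<open>Real linearity gives access to continuity and boundedness in finite dimension.\<close>

lemma linear_synthesis:
  fixes \<phi> :: "'n::finite \<Rightarrow> 'a::complex_normed_vector"
  shows "linear (synthesis \<phi>)"
proof
  fix r :: real and u :: "complex ^ 'n"
  have "r *\<^sub>R u = complex_of_real r *s u"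
    by (simp add: vec_eq_iff complex_eq_iff)
  thus "synthesis \<phi> (r *\<^sub>R u) = r *\<^sub>R synthesis \<phi> u"
    by (simp add: synthesis_scale scaleC_of_real)
qed (rule synthesis_add)

lemma range_synthesis:
  assumes "is_basis \<phi> S"
  shows "range (synthesis \<phi>) = S"
proof -
  have inj: "inj \<phi>" and "S = cvec.span (range \<phi>)"
    using assms by (auto simp: is_basis_def)
  hence S: "S = range (\<lambda>u. \<Sum>v\<in>range \<phi>. u v *\<^sub>C v)"
    by (simp add: cvec.span_finite)
  have "(\<Sum>v\<in>range \<phi>. u v *\<^sub>C v) = synthesis \<phi> (\<chi> i. u (\<phi> i))" for u
    using inj by (simp add: synthesis_def sum.reindex)
  hence "S \<subseteq> range (synthesis \<phi>)" unfolding S by auto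
  moreover have "synthesis \<phi> u = (\<Sum>v\<in>range \<phi>. u $ inv \<phi> v *\<^sub>C v)" for u
    using inj by (simp add: synthesis_def sum.reindex)
  hence "range (synthesis \<phi>) \<subseteq> S" unfolding S by auto
  ultimately show ?thesis by blast
qed

lemma synthesis_in: "is_basis \<phi> S \<Longrightarrow> synthesis \<phi> u \<in> S"
  using range_synthesis by blast

lemma synthesis_eq_0_iff:
  assumes "is_basis \<phi> S"
  shows "synthesis \<phi> u = 0 \<longleftrightarrow> u = 0"
proof
  have inj: "inj \<phi>" and ind: "cvec.independent (range \<phi>)"
    using assms by (auto simp: is_basis_def)
  assume "synthesis \<phi> u = 0"
  hence "(\<Sum>v\<in>range \<phi>. u $ inv \<phi> v *\<^sub>C v) = 0"
    using inj by (simp add: synthesis_def sum.reindex)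
  hence "u $ inv \<phi> (\<phi> i) = 0" for i
    using cvec.independentD[OF ind, of "range \<phi>" "\<lambda>v. u $ inv \<phi> v" "\<phi> i"] by simp
  thus "u = 0" using inj by (simp add: vec_eq_iff)
qed (simp add: synthesis_def)

lemma basis_nonzero:
  assumes "is_basis \<phi> S"
  shows "\<phi> i \<in> S - {0}"
proof -
  have ind: "cvec.independent (range \<phi>)" and "S = cvec.span (range \<phi>)"
    using assms by (auto simp: is_basis_def)
  thus ?thesis using cvec.span_base[of "\<phi> i" "range \<phi>"] cvec.dependent_zero[of "range \<phi>"]
    by (metis Diff_iff rangeI singletonD)
qed

text \<open>For the antilinear second argument of a form it is applied to the conjugate of the
  form.\<close>

lemma linear_functional_synthesis:
  fixes g :: "'a::complex_normed_vector \<Rightarrow> complex"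
  assumes "\<And>x y. g (x + y) = g x + g y" and "\<And>c x. g (c *\<^sub>C x) = c * g x"
  shows "g (synthesis \<phi> u) = (\<Sum>i\<in>UNIV. u $ i * g (\<phi> i))"
proof -
  have "g 0 = 0" using assms(2)[of 0 0] by simp
  hence "g (\<Sum>i\<in>I. (u $ i) *\<^sub>C \<phi> i) = (\<Sum>i\<in>I. u $ i * g (\<phi> i))" for I
    by (induction I rule: infinite_finite_induct) (auto simp: assms)
  thus ?thesis by (simp add: synthesis_def)
qed

lemma form_matrix_mult:
  fixes f :: "'a::complex_normed_vector \<Rightarrow> 'b \<Rightarrow> complex"
  assumes "\<And>x y z. f (x + y) z = f x z + f y z" and "\<And>c x z. f (c *\<^sub>C x) z = c * f x z"
  shows "(form_matrix f \<phi> \<psi> *v u) $ i = f (synthesis \<phi> u) (\<psi> i)"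
  by (simp add: linear_functional_synthesis[of "\<lambda>x. f x (\<psi> i)"] assms
      matrix_vector_mult_def form_matrix_def mult.commute)

text \<open>Norm equivalence by compactness: \<open>B\<close> is the minimum of the synthesis norm
  on the Euclidean unit sphere, positive because a basis is independent.\<close>

lemma synthesis_norm_ge:
  fixes \<phi> :: "'n::finite \<Rightarrow> 'a::complex_normed_vector"
  assumes "is_basis \<phi> S"
  obtains B where "0 < B" and "\<And>u. B * norm u \<le> norm (synthesis \<phi> u)"
proof -
  let ?S = "sphere (0 :: complex ^ 'n) 1"
  have "continuous_on ?S (\<lambda>u. norm (synthesis \<phi> u))"
    by (intro continuous_on_norm linear_continuous_on)
      (simp add: linear_synthesis flip: linear_conv_bounded_linear)
  moreover have "?S \<noteq> {}" by simp
  ultimately obtain e where e: "e \<in> ?S"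
      "\<And>u. u \<in> ?S \<Longrightarrow> norm (synthesis \<phi> e) \<le> norm (synthesis \<phi> u)"
    using continuous_attains_inf[OF compact_sphere, of 0 1] by blast
  show thesis
  proof (rule that)
    show "0 < norm (synthesis \<phi> e)"
      using e(1) synthesis_eq_0_iff[OF assms, of e] by auto
    show "norm (synthesis \<phi> e) * norm u \<le> norm (synthesis \<phi> u)" for u
    proof (cases "u = 0")
      case False
      hence "norm (synthesis \<phi> e) \<le> norm (synthesis \<phi> (u /\<^sub>R norm u))"
        by (intro e(2)) simp
      also have "\<dots> = norm (synthesis \<phi> u) / norm u"
        using linear_scale[OF linear_synthesis[of \<phi>], of "inverse (norm u)" u]
        by (simp add: field_simps)
      finally show ?thesis using False by (simp add: field_simps)
    qed simp
  qed
qed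

text \<open>Carries a contraction in the norm of the function space over to coefficient vectors. The
  loss is the supremum \<open>s\<close> of the norm quotients, paid on \<open>v\<close>, over their
  infimum \<open>i\<close>, paid on \<open>u\<close>.\<close>

lemma norm_le_synthesis_cond:
  assumes "is_basis \<phi> S" and "norm (synthesis \<phi> u) \<le> \<rho> * norm (synthesis \<phi> v)" and "0 \<le> \<rho>"
  shows "norm u \<le> synthesis_cond \<phi> * \<rho> * norm v"
proof -
  let ?U = "{u. synthesis \<phi> u \<noteq> 0}"
  let ?q = "\<lambda>u. norm (synthesis \<phi> u) / norm u"
  define s where "s = Sup (?q ` ?U)"
  define i where "i = Inf (?q ` ?U)"
  have U: "w \<in> ?U \<longleftrightarrow> w \<noteq> 0" for w
    using synthesis_eq_0_iff[OF assms(1)] by simp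
  obtain B where B: "\<And>u. norm (synthesis \<phi> u) \<le> B * norm u"
    using linear_bounded[OF linear_synthesis] by blast
  obtain D where D: "0 < D" "\<And>u. D * norm u \<le> norm (synthesis \<phi> u)"
    using synthesis_norm_ge[OF assms(1)] by blast
  have above: "bdd_above (?q ` ?U)"
    by (rule bdd_aboveI2[of _ _ B]) (use B U in \<open>auto simp: pos_divide_le_eq\<close>)
  have low: "D \<le> ?q w" if "w \<in> ?U" for w
    using D(2)[of w] that U by (simp add: pos_le_divide_eq)
  hence below: "bdd_below (?q ` ?U)" by (rule bdd_belowI2)
  \<comment> \<open>The all-ones vector shows that the infimum runs over a nonempty set, so the
    lower bound \<open>D\<close> of the quotients passes to \<open>i\<close> and division by
    \<open>i\<close> is legitimate.\<close>
  have "(\<chi> i. 1) \<in> ?U" by (simp only: U) (simp add: vec_eq_iff)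
  hence "?U \<noteq> {}" by blast
  hence "D \<le> i" unfolding i_def using low by (rule cINF_greatest)
  hence i: "0 < i" using D(1) by simp
  have upper: "norm (synthesis \<phi> w) \<le> s * norm w" for w
  proof (cases "w = 0")
    case False
    hence "?q w \<le> s" unfolding s_def using above U by (intro cSUP_upper) auto
    thus ?thesis using False by (simp add: pos_divide_le_eq)
  qed (simp add: synthesis_def)
  have lower: "i * norm w \<le> norm (synthesis \<phi> w)" for w
  proof (cases "w = 0")
    case False
    hence "i \<le> ?q w" unfolding i_def using below U by (intro cINF_lower) auto
    thus ?thesis using False by (simp add: pos_le_divide_eq)
  qed simp
  have "i * norm u \<le> \<rho> * (s * norm v)"
    using lower[of u] assms(2) mult_left_mono[OF upper[of v] assms(3)] by linarith
  hence "norm u \<le> s / i * \<rho> * norm v"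
    using i by (simp add: field_simps)
  thus ?thesis by (simp add: synthesis_cond_def s_def i_def)
qed

text \<open>The previous estimate with equal vectors and \<rho> equal to 1 even yields a value of at
  least 1; only the sign is kept.\<close>

lemma synthesis_cond_nonneg:
  fixes \<phi> :: "'n::finite \<Rightarrow> 'a::complex_normed_vector"
  assumes "is_basis \<phi> S"
  shows "0 \<le> synthesis_cond \<phi>"
proof -
  let ?e = "(\<chi> i. 1) :: complex ^ 'n"
  have "?e \<noteq> 0" by (simp add: vec_eq_iff)
  hence e: "0 < norm ?e" by (rule zero_less_norm_iff[THEN iffD2])
  have "norm ?e \<le> synthesis_cond \<phi> * 1 * norm ?e"
    by (rule norm_le_synthesis_cond[OF assms]) simp_all
  hence "0 \<le> synthesis_cond \<phi> * norm ?e"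
    using e by linarith
  thus ?thesis using e by (simp only: zero_le_mult_iff) linarith
qed

section \<open>Inf-sup stable forms\<close>

text \<open>By antilinearity \<open>f u\<close> vanishes on all of \<open>T\<close>, so the supremum
  in the inf-sup condition is 0 and the positive constant forces \<open>u = 0\<close>.\<close>

lemma inf_sup_eq_0:
  assumes "inf_sup f S T \<gamma>" and "is_basis \<psi> T" and "bounded_sesquilinear f"
    and "u \<in> S" and zero: "\<And>i. f u (\<psi> i) = 0"
  shows "u = 0"
proof -
  have "f u v = 0" if v: "v \<in> T" for v
  proof -
    obtain w where w: "v = synthesis \<psi> w"
      using v range_synthesis[OF assms(2)] by blast
    have "cnj (f u v) = (\<Sum>i\<in>UNIV. w $ i * cnj (f u (\<psi> i)))"
      unfolding w by (rule linear_functional_synthesis)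
        (use assms(3) in \<open>auto simp: bounded_sesquilinear_def\<close>)
    thus ?thesis by (simp add: zero)
  qed
  hence "(SUP v\<in>T - {0}. cmod (f u v) / norm v) = (SUP v\<in>T - {0}. (0::real))"
    by (intro SUP_cong) auto
  \<comment> \<open>The supremum of a constant needs a nonempty index set, which a basis vector
    provides.\<close>
  also have "\<dots> = 0" using basis_nonzero[OF assms(2)] by (intro cSUP_const) blast
  finally have "\<gamma> * norm u \<le> 0" and "\<gamma> > 0"
    using assms(1,4) unfolding inf_sup_def by auto
  thus ?thesis by (simp add: mult_le_0_iff)
qed

section \<open>Form matrices and discrete operators in coordinates\<close>

lemma matrix_inv_inverse:
  assumes "invertible B"
  shows "matrix_inv B ** B = mat 1" and "B ** matrix_inv B = mat 1"
  using someI_ex[OF assms[unfolded invertible_def]] unfolding matrix_inv_def by auto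

lemma invertible_matrix_inv: "invertible B \<Longrightarrow> invertible (matrix_inv B)"
  using matrix_inv_inverse unfolding invertible_def by blast

lemma bounded_sesquilinear_diff_left:
  assumes "bounded_sesquilinear f"
  shows "f (x - y) z = f x z - f y z"
proof -
  have "f ((x - y) + y) z = f (x - y) z + f y z"
    using assms unfolding bounded_sesquilinear_def by blast
  thus ?thesis by simp
qed

lemma form_matrix_mult_sesquilinear:
  assumes "bounded_sesquilinear f"
  shows "(form_matrix f \<phi> \<psi> *v u) $ i = f (synthesis \<phi> u) (\<psi> i)"
  by (rule form_matrix_mult) (use assms in \<open>auto simp: bounded_sesquilinear_def\<close>)

text \<open>Inf-sup stability makes the kernel trivial. The matrix is square since both bases share
  the index type, so a left inverse is enough.\<close>

lemma invertible_form_matrix: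
  assumes "inf_sup f S T \<gamma>" and "bounded_sesquilinear f" and "is_basis \<phi> S" and "is_basis \<psi> T"
  shows "invertible (form_matrix f \<phi> \<psi>)"
proof -
  have "u = 0" if "form_matrix f \<phi> \<psi> *v u = 0" for u
  proof -
    have "f (synthesis \<phi> u) (\<psi> i) = 0" for i
      using that form_matrix_mult_sesquilinear[OF assms(2), of \<phi> \<psi> u i] by simp
    hence "synthesis \<phi> u = 0"
      using inf_sup_eq_0[OF assms(1,4,2) synthesis_in[OF assms(3)]] by blast
    thus ?thesis using synthesis_eq_0_iff[OF assms(3)] by blast
  qed
  thus ?thesis
    using matrix_left_invertible_ker invertible_left_inverse by blast
qed

text \<open>Two different forms are allowed so that images under two operators into the same
  antidual can be compared. Outside \<open>T\<close> both functionals are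
  \<open>undefined\<close>.\<close>

lemma discrete_op_eq_iff:
  assumes "bounded_sesquilinear f" and "bounded_sesquilinear g" and "is_basis \<psi> T"
    and "u \<in> S" and "v \<in> S'"
  shows "discrete_op f S T u = discrete_op g S' T v \<longleftrightarrow> (\<forall>i. f u (\<psi> i) = g v (\<psi> i))"
proof
  assume eq: "discrete_op f S T u = discrete_op g S' T v"
  have "f u (\<psi> i) = g v (\<psi> i)" for i
    using fun_cong[OF eq, of "\<psi> i"] assms(4,5) basis_nonzero[OF assms(3), of i]
    by (simp add: discrete_op_def)
  thus "\<forall>i. f u (\<psi> i) = g v (\<psi> i)" ..
next
  assume eq: "\<forall>i. f u (\<psi> i) = g v (\<psi> i)"
  have "f u y = g v y" if y: "y \<in> T" for y
  proof -
    obtain w where w: "y = synthesis \<psi> w"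
      using y range_synthesis[OF assms(3)] by blast
    have "cnj (f u y) = (\<Sum>i\<in>UNIV. w $ i * cnj (f u (\<psi> i)))"
      unfolding w by (rule linear_functional_synthesis)
        (use assms(1) in \<open>auto simp: bounded_sesquilinear_def\<close>)
    moreover have "cnj (g v y) = (\<Sum>i\<in>UNIV. w $ i * cnj (g v (\<psi> i)))"
      unfolding w by (rule linear_functional_synthesis)
        (use assms(2) in \<open>auto simp: bounded_sesquilinear_def\<close>)
    ultimately show ?thesis using eq by (simp add: complex_eq_iff)
  qed
  thus "discrete_op f S T u = discrete_op g S' T v"
    using assms(4,5) by (auto simp: discrete_op_def)
qed

lemma inj_on_discrete_op:
  assumes "inf_sup f S T \<gamma>" and "bounded_sesquilinear f" and "is_basis \<psi> T" and "cvec.subspace S"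
  shows "inj_on (discrete_op f S T) S"
proof (rule inj_onI)
  fix u v assume uv: "u \<in> S" "v \<in> S" "discrete_op f S T u = discrete_op f S T v"
  hence "f (u - v) (\<psi> i) = 0" for i
    using discrete_op_eq_iff[OF assms(2,2,3)] by (simp add: bounded_sesquilinear_diff_left[OF assms(2)])
  moreover have "u - v \<in> S" using uv assms(4) by (simp add: cvec.subspace_diff)
  ultimately show "u = v"
    using inf_sup_eq_0[OF assms(1,3,2)] by fastforce
qed

text \<open>By injectivity \<open>inv_into\<close> returns any preimage that is exhibited, here the
  solution of the linear system with matrix \<open>form_matrix n\<close>. It serves both factors of
  the preconditioned operator.\<close>

lemma inv_discrete_op_synthesis:
  assumes "inf_sup n V Y \<gamma>" and "bounded_sesquilinear n" and "bounded_sesquilinear a"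
    and "is_basis \<phi> X" and "is_basis \<psi> V" and "is_basis \<eta> Y" and "cvec.subspace V"
  shows "inv_into V (discrete_op n V Y) (discrete_op a X Y (synthesis \<phi> u)) =
    synthesis \<psi> ((matrix_inv (form_matrix n \<psi> \<eta>) ** form_matrix a \<phi> \<eta>) *v u)"
    (is "_ = synthesis \<psi> ?w")
proof (rule inv_into_f_eq)
  show "inj_on (discrete_op n V Y) V"
    using assms(1,2,6,7) by (rule inj_on_discrete_op)
  show "synthesis \<psi> ?w \<in> V" using assms(5) by (rule synthesis_in)
  have "form_matrix n \<psi> \<eta> *v ?w = form_matrix a \<phi> \<eta> *v u"
    using invertible_form_matrix[OF assms(1,2,5,6)]
    by (simp add: matrix_vector_mul_assoc matrix_mul_assoc matrix_inv_inverse)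
  hence "n (synthesis \<psi> ?w) (\<eta> i) = a (synthesis \<phi> u) (\<eta> i)" for i
    by (metis assms(2,3) form_matrix_mult_sesquilinear)
  thus "discrete_op n V Y (synthesis \<psi> ?w) = discrete_op a X Y (synthesis \<phi> u)"
    using discrete_op_eq_iff[OF assms(2,3,6) synthesis_in[OF assms(5)] synthesis_in[OF assms(4)]]
    by blast
qed

text \<open>A real supremum is meaningful only for a bounded nonempty set: boundedness of the form
  gives the first, the basis vectors at an arbitrary index the second.\<close>

lemma form_norm_nonneg:
  fixes f :: "'a::complex_normed_vector \<Rightarrow> 'b::complex_normed_vector \<Rightarrow> complex"
    and S :: "'a set" and T :: "'b set"
  assumes "bounded_sesquilinear f" and "is_basis \<phi> S" and "is_basis \<psi> T"
  shows "0 \<le> form_norm f"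
proof -
  obtain K where K: "\<And>x y. cmod (f x y) \<le> K * norm x * norm y"
    using assms(1) unfolding bounded_sesquilinear_def by blast
  let ?q = "\<lambda>(x, y). cmod (f x y) / (norm x * norm y)"
  let ?D = "(UNIV - {0}) \<times> (UNIV - {0})"
  have "cmod (f x y) / (norm x * norm y) \<le> K" if "x \<noteq> 0" "y \<noteq> 0" for x y
    using that K[of x y] pos_divide_le_eq[of "norm x * norm y" "cmod (f x y)" K]
    by (simp add: mult.assoc)
  hence "bdd_above (?q ` ?D)" by (intro bdd_aboveI2[of _ _ K]) auto
  moreover have "(\<phi> undefined, \<psi> undefined) \<in> ?D"
    using basis_nonzero[OF assms(2)] basis_nonzero[OF assms(3)] by blast
  ultimately show ?thesis
    unfolding form_norm_def
    by (rule cSUP_upper2) simp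
qed

section \<open>Field of values\<close>

lemma cinner_self: "cinner x x = complex_of_real ((norm (x::'a::complex_hilbert))\<^sup>2)"
proof -
  have "Im (cinner x x) = 0"
    using cinner_commute[of x x] by (simp add: complex_eq_iff)
  thus ?thesis by (simp add: complex_eq_iff norm_eq_sqrt_cinner cinner_ge_zero)
qed

lemma cinner_right:
  fixes x y z :: "'a::complex_hilbert"
  shows "cinner z (x + y) = cinner z x + cinner z y"
    and "cinner z (c *\<^sub>C x) = cnj c * cinner z x"
  using cinner_add_left[of x y z] cinner_scaleC_left[of c x z]
  by (metis cinner_commute complex_cnj_add, metis cinner_commute complex_cnj_mult)

text \<open>Weighted GMRES thus measures residuals in the norm of \<open>X\<close>. Entry
  \<open>i\<close> of the Gram product is the inner product of the synthesised vector with
  \<phi>\<open>i\<close>.\<close>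

lemma gram_norm_eq: "gram_norm \<phi> u = norm (synthesis \<phi> u)"
proof -
  let ?L = "synthesis \<phi> u"
  have "(\<Sum>i\<in>UNIV. (form_matrix cinner \<phi> \<phi> *v u) $ i * cnj (u $ i))
      = cnj (\<Sum>i\<in>UNIV. u $ i * cinner (\<phi> i) ?L)"
    by (simp add: form_matrix_mult cinner_add_left cinner_scaleC_left mult.commute
        cinner_commute[of ?L])
  also have "(\<Sum>i\<in>UNIV. u $ i * cinner (\<phi> i) ?L) = cinner ?L ?L"
    by (rule linear_functional_synthesis[symmetric])
      (simp_all add: cinner_add_left cinner_scaleC_left)
  finally show ?thesis by (simp add: gram_norm_def norm_eq_sqrt_cinner)
qed

lemma field_of_values_dist_le:
  assumes "u \<in> S" and "u \<noteq> 0"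
  shows "field_of_values_dist S Q \<le> cmod (cinner (Q u) u) / (norm u)\<^sup>2"
proof -
  have "field_of_values_dist S Q \<le> cmod (cinner (Q u) u) / Re (cinner u u)"
    unfolding field_of_values_dist_def using assms
    by (intro cINF_lower bdd_belowI2[of _ 0]) (auto simp: cinner_ge_zero)
  thus ?thesis by (simp add: cinner_self)
qed

text \<open>Pythagoras: the subtracted multiple of \<open>s\<close> is the orthogonal projection of
  \<open>r\<close> onto its line.\<close>

lemma norm_diff_projection:
  fixes r s :: "'a::complex_hilbert"
  assumes "s \<noteq> 0"
  shows "(norm (r - (cinner r s / (norm s)\<^sup>2) *\<^sub>C s))\<^sup>2 = (norm r)\<^sup>2 - (cmod (cinner r s))\<^sup>2 / (norm s)\<^sup>2"
proof -
  define z where "z = cinner r s"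
  define \<alpha> where "\<alpha> = - (z / (norm s)\<^sup>2)"
  have "complex_of_real ((norm (r + \<alpha> *\<^sub>C s))\<^sup>2) = cinner (r + \<alpha> *\<^sub>C s) (r + \<alpha> *\<^sub>C s)"
    by (simp add: cinner_self)
  also have "\<dots> = cinner r r + cnj \<alpha> * z + \<alpha> * cnj z + \<alpha> * cnj \<alpha> * cinner s s"
    by (simp add: cinner_right cinner_add_left cinner_scaleC_left z_def cinner_commute[of s r]
        algebra_simps)
  also have "\<dots> = (norm r)\<^sup>2 - z * cnj z / (norm s)\<^sup>2"
    using assms by (simp add: cinner_self \<alpha>_def field_simps power2_eq_square
        flip: complex_norm_square)
  also have "\<dots> = complex_of_real ((norm r)\<^sup>2 - (cmod z)\<^sup>2 / (norm s)\<^sup>2)"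
    by (simp add: complex_norm_square flip: of_real_power)
  finally have "(norm (r + \<alpha> *\<^sub>C s))\<^sup>2 = (norm r)\<^sup>2 - (cmod z)\<^sup>2 / (norm s)\<^sup>2"
    using of_real_eq_iff by blast
  thus ?thesis by (simp add: \<alpha>_def z_def)
qed

text \<open>The two bounds concern one modulus, normalised by the squared norm of \<open>r\<close>
  and of \<open>s\<close>. Their product is the squared cosine of the angle between \<open>r\<close>
  and \<open>s\<close>, the relative loss under projection.\<close>

lemma residual_step:
  fixes r s :: "'a::complex_hilbert"
  assumes "0 \<le> p" "0 \<le> q" "s \<noteq> 0" "r \<noteq> 0"
    and "p \<le> cmod (cinner s r) / (norm r)\<^sup>2" and "q \<le> cmod (cinner r s) / (norm s)\<^sup>2"
  obtains \<alpha> where "norm (r - \<alpha> *\<^sub>C s) \<le> sqrt (1 - p * q) * norm r" and "p * q \<le> 1"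
proof -
  define \<alpha> where "\<alpha> = cinner r s / (norm s)\<^sup>2"
  have "cmod (cinner s r) = cmod (cinner r s)"
    by (metis cinner_commute complex_mod_cnj)
  hence "p * q \<le> cmod (cinner r s) / (norm r)\<^sup>2 * (cmod (cinner r s) / (norm s)\<^sup>2)"
    using assms by (intro mult_mono) auto
  hence "p * q * (norm r)\<^sup>2 \<le> (cmod (cinner r s))\<^sup>2 / (norm s)\<^sup>2"
    using assms(3,4) by (simp add: field_simps power2_eq_square)
  hence le: "(norm (r - \<alpha> *\<^sub>C s))\<^sup>2 \<le> (1 - p * q) * (norm r)\<^sup>2"
    unfolding \<alpha>_def norm_diff_projection[OF assms(3)] by (simp add: algebra_simps)
  \<comment> \<open>Since the left side of \<open>le\<close> is a square, \<open>p * q\<close>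
    cannot exceed 1; this later makes the contraction factor nonnegative.\<close>
  hence "0 \<le> (1 - p * q) * (norm r)\<^sup>2"
    using zero_le_power2 order_trans by blast
  hence "p * q \<le> 1" using assms(4) by (simp add: zero_le_mult_iff)
  moreover have "norm (r - \<alpha> *\<^sub>C s) \<le> sqrt (1 - p * q) * norm r"
    using real_le_rsqrt[OF le] by (simp add: real_sqrt_mult)
  ultimately show thesis by (rule that[rotated])
qed

section \<open>Convergence rates of weighted and Euclidean GMRES\<close>

theorem theorem3:
  fixes a :: "'x::complex_hilbert \<Rightarrow> 'y::complex_banach \<Rightarrow> complex"
    and c :: "'v::complex_banach \<Rightarrow> 'w::complex_banach \<Rightarrow> complex"
    and n :: "'v \<Rightarrow> 'y \<Rightarrow> complex"
    and m :: "'x \<Rightarrow> 'w \<Rightarrow> complex"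
    and b :: "'y \<Rightarrow> complex"
    and Xh :: "'x set" and Yh :: "'y set" and Vh :: "'v set" and Wh :: "'w set"
    and \<gamma>A \<gamma>C \<gamma>N \<gamma>M :: real
    and \<phi> :: "'n::finite \<Rightarrow> 'x" and \<eta> :: "'n \<Rightarrow> 'y"
    and \<psi> :: "'n \<Rightarrow> 'v" and \<xi> :: "'n \<Rightarrow> 'w"
    and x0 :: "complex ^ 'n" and x xt :: "nat \<Rightarrow> complex ^ 'n"
    and k mm :: nat
  defines "Ah \<equiv> discrete_op a Xh Yh"
    and "Ch \<equiv> discrete_op c Vh Wh"
    and "Nh \<equiv> discrete_op n Vh Yh"
    and "Mh \<equiv> discrete_op m Xh Wh"
  defines "Ph \<equiv> inv_into Xh Mh \<circ> Ch \<circ> inv_into Vh Nh"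
  defines "A \<equiv> form_matrix a \<phi> \<eta>"
    and "C \<equiv> form_matrix c \<psi> \<xi>"
    and "N \<equiv> form_matrix n \<psi> \<eta>"
    and "M \<equiv> form_matrix m \<phi> \<xi>"
    and "bv \<equiv> (\<chi> i. b (\<eta> i))"
  defines "P \<equiv> matrix_inv M ** C ** matrix_inv N"
  defines "K \<equiv> (form_norm m * form_norm n * form_norm c * form_norm a) / (\<gamma>M * \<gamma>N * \<gamma>C * \<gamma>A)"
  assumes "reflexive_space TYPE('y)" and "reflexive_space TYPE('v)"
    and "reflexive_space TYPE('w)"
    and "bounded_sesquilinear a" and "bounded_sesquilinear c"
    and "bounded_sesquilinear n" and "bounded_sesquilinear m"
    and "b \<in> antidual UNIV"
    and "\<forall>g\<in>antidual UNIV. \<exists>!u. \<forall>v. a u v = g v"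
    and "cvec.subspace Xh" and "cvec.subspace Yh"
    and "cvec.subspace Vh" and "cvec.subspace Wh"
    and "cvec.dim Xh = CARD('n)" and "cvec.dim Yh = CARD('n)"
    and "cvec.dim Vh = CARD('n)" and "cvec.dim Wh = CARD('n)"
    and "inf_sup a Xh Yh \<gamma>A" and "inf_sup c Vh Wh \<gamma>C"
    and "inf_sup n Vh Yh \<gamma>N" and "inf_sup m Xh Wh \<gamma>M"
    and "is_basis \<phi> Xh" and "is_basis \<eta> Yh" and "is_basis \<psi> Vh" and "is_basis \<xi> Wh"
    and "\<gamma>C * \<gamma>A / (form_norm m * form_norm n) \<le> field_of_values_dist Xh (Ph \<circ> Ah)"
    and "\<gamma>M * \<gamma>N / (form_norm c * form_norm a)
           \<le> field_of_values_dist Xh (inv_into Xh (Ph \<circ> Ah))"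
    and "(P ** A) *v x0 \<noteq> P *v bv"
    and "gmres_iterates (gram_norm \<phi>) (P ** A) (P *v bv) mm x0 x"
    and "gmres_iterates norm (P ** A) (P *v bv) mm x0 xt"
    and "1 \<le> k" and "k \<le> CARD('n)" and "1 \<le> mm" and "mm \<le> CARD('n)"
  shows "convergence_rate (gram_norm \<phi>) P A bv x k \<le> sqrt (1 - 1 / K) \<and>
         convergence_rate norm P A bv xt k \<le> synthesis_cond \<phi> * sqrt (1 - 1 / K)"
proof -
  define p where "p = \<gamma>C * \<gamma>A / (form_norm m * form_norm n)"
  define q where "q = \<gamma>M * \<gamma>N / (form_norm c * form_norm a)"
  define Q where "Q = P ** A"
  note bases = \<open>is_basis \<phi> Xh\<close> \<open>is_basis \<eta> Yh\<close> \<open>is_basis \<psi> Vh\<close> \<open>is_basis \<xi> Wh\<close>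
  note infsup = \<open>inf_sup a Xh Yh \<gamma>A\<close> \<open>inf_sup c Vh Wh \<gamma>C\<close>
    \<open>inf_sup n Vh Yh \<gamma>N\<close> \<open>inf_sup m Xh Wh \<gamma>M\<close>
  have inv: "invertible A" "invertible C" "invertible N" "invertible M"
    unfolding M_def C_def N_def A_def
    by (rule invertible_form_matrix; fact)+
  have "0 \<le> form_norm a" "0 \<le> form_norm c" "0 \<le> form_norm n" "0 \<le> form_norm m"
    by (rule form_norm_nonneg; fact)+
  moreover have "0 < \<gamma>A" "0 < \<gamma>C" "0 < \<gamma>N" "0 < \<gamma>M"
    using infsup by (simp_all add: inf_sup_def)
  ultimately have p: "0 \<le> p" and q: "0 \<le> q"
    by (simp_all add: p_def q_def)
  \<comment> \<open>Holds also for a vanishing form norm, as division by 0 gives 0 on both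
    sides.\<close>
  have pq: "1 / K = p * q"
    by (simp add: K_def p_def q_def mult_ac)
  \<comment> \<open>The matrix \<open>Q\<close> represents the preconditioned operator in the basis
    of \<open>Xh\<close>, so the field of values can be tested at synthesised vectors.\<close>
  have op: "(Ph \<circ> Ah) (synthesis \<phi> u) = synthesis \<phi> (Q *v u)" for u
  proof -
    have "inv_into Vh Nh (Ah (synthesis \<phi> u)) = synthesis \<psi> ((matrix_inv N ** A) *v u)"
      unfolding Nh_def Ah_def N_def A_def
      by (rule inv_discrete_op_synthesis; fact)
    moreover have "inv_into Xh Mh (Ch (synthesis \<psi> v)) = synthesis \<phi> ((matrix_inv M ** C) *v v)" for v
      unfolding Mh_def Ch_def M_def C_def
      by (rule inv_discrete_op_synthesis; fact)
    ultimately show ?thesis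
      by (simp add: Ph_def Q_def P_def matrix_vector_mul_assoc matrix_mul_assoc)
  qed
  have "invertible Q"
    unfolding Q_def P_def using inv by (intro invertible_mult invertible_matrix_inv)
  hence Q0: "Q *v u = 0 \<Longrightarrow> u = 0" for u
    by (metis matrix_inv_inverse(1) matrix_vector_mul_assoc matrix_vector_mul_lid
        matrix_vector_mult_0_right)
  have inj: "inj_on (Ph \<circ> Ah) Xh"
  proof (rule inj_onI)
    fix y z assume "y \<in> Xh" "z \<in> Xh" and eq: "(Ph \<circ> Ah) y = (Ph \<circ> Ah) z"
    then obtain u v where uv: "y = synthesis \<phi> u" "z = synthesis \<phi> v"
      using range_synthesis[OF bases(1)] by blast
    have "synthesis \<phi> (Q *v (u - v)) = 0"
      using eq unfolding uv op by (simp add: synthesis_diff matrix_vector_mult_diff_distrib)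
    hence "u - v = 0"
      using Q0 synthesis_eq_0_iff[OF bases(1)] by blast
    thus "y = z" by (simp add: uv)
  qed
  \<comment> \<open>The bound on \<open>1 / K\<close> is carried along because it, too, is derived
    from a nonzero vector.\<close>
  have step: "\<exists>\<alpha>. gram_norm \<phi> (r - \<alpha> *s (Q *v r)) \<le> sqrt (1 - 1 / K) * gram_norm \<phi> r
      \<and> 1 / K \<le> 1" if r: "r \<noteq> 0" for r
  proof -
    let ?r = "synthesis \<phi> r" and ?s = "synthesis \<phi> (Q *v r)"
    have nz: "?r \<noteq> 0" "?s \<noteq> 0"
      using r Q0 synthesis_eq_0_iff[OF bases(1)] by blast+
    have Xh: "?r \<in> Xh" "?s \<in> Xh"
      using synthesis_in[OF bases(1)] by blast+
    have "p \<le> field_of_values_dist Xh (Ph \<circ> Ah)"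
      unfolding p_def by fact
    also have "\<dots> \<le> cmod (cinner ?s ?r) / (norm ?r)\<^sup>2"
      using field_of_values_dist_le[OF Xh(1) nz(1), of "Ph \<circ> Ah"] by (simp only: op)
    finally have p_le: "p \<le> cmod (cinner ?s ?r) / (norm ?r)\<^sup>2" .
    \<comment> \<open>Evaluating the inverse at \<open>?s\<close> returns \<open>?r\<close>, so its
      field of values involves the same pair of vectors with roles exchanged.\<close>
    have inv_s: "inv_into Xh (Ph \<circ> Ah) ?s = ?r"
      using inv_into_f_f[OF inj Xh(1)] by (simp only: op)
    have "q \<le> field_of_values_dist Xh (inv_into Xh (Ph \<circ> Ah))"
      unfolding q_def by fact
    also have "\<dots> \<le> cmod (cinner ?r ?s) / (norm ?s)\<^sup>2"
      using field_of_values_dist_le[OF Xh(2) nz(2), of "inv_into Xh (Ph \<circ> Ah)"]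
      by (simp only: inv_s)
    finally obtain \<alpha> where "norm (?r - \<alpha> *\<^sub>C ?s) \<le> sqrt (1 - p * q) * norm ?r" "p * q \<le> 1"
      using residual_step[OF p q nz(2,1) p_le] by blast
    thus ?thesis
      by (auto simp: gram_norm_eq pq synthesis_diff synthesis_scale)
  qed
  define \<rho> where "\<rho> = sqrt (1 - 1 / K)"
  have res0: "P *v bv - Q *v x0 \<noteq> 0"
    using \<open>(P ** A) *v x0 \<noteq> P *v bv\<close> by (simp add: Q_def)
  \<comment> \<open>The nonzero initial residual supplies the vector at which \<open>step\<close>
    gives \<open>1 / K\<close> at most 1.\<close>
  hence \<rho>: "0 \<le> \<rho>" using step by (auto simp: \<rho>_def)
  have gram: "\<exists>\<alpha>. gram_norm \<phi> (r - \<alpha> *s (Q *v r)) \<le> \<rho> * gram_norm \<phi> r" for r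
    using step[of r] by (cases "r = 0") (auto simp: \<rho>_def gram_norm_eq synthesis_def)
  \<comment> \<open>The weighted choice of \<alpha> is reused; it is a valid competitor for
    Euclidean minimisation.\<close>
  have eucl: "\<exists>\<alpha>. norm (r - \<alpha> *s (Q *v r)) \<le> synthesis_cond \<phi> * \<rho> * norm r" for r
    using gram[of r] norm_le_synthesis_cond[OF bases(1) _ \<rho>] unfolding gram_norm_eq by blast
  have "convergence_rate (gram_norm \<phi>) P A bv x k \<le> \<rho>"
  proof (rule convergence_rate_le)
    show "0 < gram_norm \<phi> (P *v bv - (P ** A) *v x0)"
      using res0 synthesis_eq_0_iff[OF bases(1)] by (simp add: gram_norm_eq Q_def)
  qed (fact \<rho> gram[unfolded Q_def] | fact)+
  moreover have "convergence_rate norm P A bv xt k \<le> synthesis_cond \<phi> * \<rho>"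
  proof (rule convergence_rate_le)
    show "0 < norm (P *v bv - (P ** A) *v x0)" using res0 by (simp add: Q_def)
    show "0 \<le> synthesis_cond \<phi> * \<rho>" using \<rho> synthesis_cond_nonneg[OF bases(1)] by simp
  qed (fact eucl[unfolded Q_def] | fact)+
  ultimately show ?thesis by (simp add: \<rho>_def)
qed

end
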